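(* Let $n$ and $k$ be positive integers with $k\leq (n+1)/2$. Then \[\mathrm{BoNa}(n,k)=\frac{1}{n} \binom{n}{k-1} \sum_{j=0}^{k-1} 2^j \binom{k-1}{j}\binom{n-k+1}{j+1}.\]
   Context: A binary plane tree is a rooted plane tree on unlabeled vertices in which every non-leaf vertex has one or two children, and every child is a left child or a right child, even if it is the only child of its parent. A 0-1-tree is a binary plane tree in which every vertex that has two children is labeled 0 or 1 (no other vertex is labeled). A right edge is an edge connecting a vertex to its right child. For $n\ge 1$, the Boolean-Narayana number $\mathrm{BoNa}(n,k)$ is the number of 0-1-trees on $n$ vertices that have exactly $k-1$ right edges. *)

theory Defs
  imports Complex_Main "HOL-Library.Tree"
begin

text \<open>
  A binary plane tree is a nonempty value of the library type \<open>'a tree\<close>: \<open>Node\<close> is a vertex, and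
  \<open>Leaf\<close> is an absent child (so a vertex with no children is \<open>Node Leaf a Leaf\<close>). Hence an only
  child is still either a left or a right child, and \<open>size\<close> counts vertices.

  The node entry carries the label: \<open>None\<close> is "unlabeled", while \<open>Some False\<close> and \<open>Some True\<close> stand
  for the labels 0 and 1. The empty tree satisfies the predicate below, to make the recursion
  uniform; it is not a rooted tree, and it is excluded whenever the number of vertices is positive.
\<close>

fun zero_one_tree :: "bool option tree \<Rightarrow> bool" where
  "zero_one_tree Leaf \<longleftrightarrow> True"
| "zero_one_tree (Node l a r) \<longleftrightarrow>
     (a \<noteq> None \<longleftrightarrow> l \<noteq> Leaf \<and> r \<noteq> Leaf) \<and> zero_one_tree l \<and> zero_one_tree r"

fun right_edges :: "'a tree \<Rightarrow> nat" where
  "right_edges Leaf = 0"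
| "right_edges (Node l a r) =
     right_edges l + right_edges r + (if r = Leaf then 0 else 1)"

text \<open>Exactly \<open>k - 1\<close> right edges, written without truncated subtraction. Meant for \<open>n \<ge> 1\<close>.\<close>

definition BoNa :: "nat \<Rightarrow> nat \<Rightarrow> nat" where
  "BoNa n k = card {t. zero_one_tree t \<and> size t = n \<and> right_edges t + 1 = k}"

end

theory Submission
  imports Defs "HOL-Computational_Algebra.Polynomial_FPS"
begin

text \<open>
  Decomposing a 0-1-tree at its root shows that the generating function \<open>T\<close>, with \<open>x\<close> marking
  vertices and \<open>y\<close> marking right edges, satisfies \<open>T = x \<phi>(T)\<close> for
  \<open>\<phi>(u) = 1 + (1 + y) u + 2 y u\<^sup>2\<close>. Lagrange inversion gives
  \<open>n [x\<^sup>n] T = [u\<^sup>n\<^sup>-\<^sup>1] \<phi>(u)\<^sup>n\<close>, and splitting \<open>\<phi>(u) = (1 + u) + y u (1 + 2 u)\<close> with the binomial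
  theorem isolates the coefficient of \<open>y\<^sup>k\<^sup>-\<^sup>1\<close>.
\<close>

unbundle fps_syntax

section \<open>Lagrange inversion for formal power series\<close>

lemma fps_power_nth_eq_0:
  fixes T :: "'a::comm_ring_1 fps"
  assumes "T $ 0 = 0" "n < r"
  shows "(T ^ r) $ n = 0"
  using startsby_zero_power_prefix[OF assms(1), of r] assms(2) by blast

lemma coeff_X_mult_pderiv:
  "coeff ([:0, 1:] * pderiv p) n = of_nat n * coeff p n"
  by (cases n) (simp_all add: coeff_pderiv)

text \<open>
  Induction on \<open>n\<close>: \<open>T ^ Suc r = X * \<phi>(T) * T ^ r\<close> expresses the \<open>n\<close>-th coefficient through the
  \<open>(n - 1)\<close>-st coefficients of higher powers, and the weights \<open>s + i\<close> brought in by the induction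
  hypothesis turn \<open>\<Sum>i. i \<phi>\<^sub>i u ^ i\<close> into \<open>u * \<phi>'\<close>, hence into the derivative of \<open>\<phi> ^ n\<close>.
\<close>

lemma lagrange_inversion:
  fixes T :: "'a::{idom, ring_char_0} fps" and \<phi> :: "'a poly"
  assumes T: "T = fps_X * (\<Sum>i\<le>degree \<phi>. fps_const (coeff \<phi> i) * T ^ i)"
    and "r \<le> n"
  shows "of_nat n * (T ^ r) $ n = of_nat r * coeff (\<phi> ^ n) (n - r)"
proof -
  have T0: "T $ 0 = 0"
    by (subst T) simp
  have power_Suc_nth: "(T ^ Suc r) $ Suc n = (\<Sum>i\<le>n - r. coeff \<phi> i * (T ^ (r + i)) $ n)"
    if "r \<le> n" for r n
  proof -
    have "T ^ Suc r = fps_X * (\<Sum>i\<le>degree \<phi>. fps_const (coeff \<phi> i) * T ^ (r + i))"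
      by (simp only: power_Suc, subst (1) T)
        (simp add: sum_distrib_right sum_distrib_left power_add mult_ac)
    then have "(T ^ Suc r) $ Suc n = (\<Sum>i\<le>degree \<phi>. coeff \<phi> i * (T ^ (r + i)) $ n)"
      by (simp add: fps_sum_nth)
    \<comment> \<open>Passing through the larger bound changes the range: coefficients of \<phi>
      vanish beyond its degree, and \<open>T ^ (r + i)\<close> has no terms of degree below
      \<open>r + i\<close>.\<close>
    also have "\<dots> = (\<Sum>i\<le>max (degree \<phi>) (n - r). coeff \<phi> i * (T ^ (r + i)) $ n)"
      by (intro sum.mono_neutral_left) (auto simp: coeff_eq_0)
    also have "\<dots> = (\<Sum>i\<le>n - r. coeff \<phi> i * (T ^ (r + i)) $ n)"
      using that by (intro sum.mono_neutral_right) (auto intro!: fps_power_nth_eq_0 T0)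
    finally show ?thesis .
  qed
  show ?thesis
    using \<open>r \<le> n\<close>
  proof (induction n arbitrary: r)
    case 0
    then show ?case by simp
  next
    case (Suc n)
    show ?case
    proof (cases r)
      case 0
      then show ?thesis by simp
    next
      case (Suc s)
      then have s: "s \<le> n" using Suc.prems by simp
      define N where "N = n - s"
      have Nle: "s + N = n" using s by (simp add: N_def)
      show ?thesis
      \<comment> \<open>The argument below ends by cancelling a factor \<open>n\<close>, so
        \<open>n = 0\<close> is settled directly.\<close>
      proof (cases "n = 0")
        case True
        then show ?thesis using power_Suc_nth[OF s] s Suc by simp
      next
        case False
        let ?c = "coeff (\<phi> ^ Suc n) N"
        have "of_nat n * (T ^ Suc s) $ Suc n
            = (\<Sum>i\<le>N. coeff \<phi> i * (of_nat n * (T ^ (s + i)) $ n))"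
          by (simp only: power_Suc_nth[OF s] N_def sum_distrib_left mult_ac)
        also have "\<dots> = (\<Sum>i\<le>N. coeff \<phi> i * (of_nat (s + i) * coeff (\<phi> ^ n) (N - i)))"
        proof (intro sum.cong refl)
          fix i assume "i \<in> {..N}"
          then have "s + i \<le> n" "n - (s + i) = N - i" using Nle by auto
          then show "coeff \<phi> i * (of_nat n * (T ^ (s + i)) $ n)
              = coeff \<phi> i * (of_nat (s + i) * coeff (\<phi> ^ n) (N - i))"
            using Suc.IH[of "s + i"] by simp
        qed
        also have "\<dots> = of_nat s * (\<Sum>i\<le>N. coeff \<phi> i * coeff (\<phi> ^ n) (N - i))
            + (\<Sum>i\<le>N. coeff ([:0, 1:] * pderiv \<phi>) i * coeff (\<phi> ^ n) (N - i))"
          by (simp only: coeff_X_mult_pderiv)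
            (simp add: sum_distrib_left sum.distrib[symmetric] algebra_simps)
        also have "\<dots> = of_nat s * ?c + coeff ([:0, 1:] * pderiv \<phi> * \<phi> ^ n) N"
          by (simp only: coeff_mult power_Suc)
        \<comment> \<open>The factor \<open>Suc n\<close> completes \<phi>' \<phi>^n to the
          derivative of \<phi>^(n+1), avoiding division in the ring.\<close>
        finally have "of_nat (Suc n) * (of_nat n * (T ^ Suc s) $ Suc n)
            = of_nat (Suc n) * of_nat s * ?c
              + coeff (smult (of_nat (Suc n)) ([:0, 1:] * pderiv \<phi> * \<phi> ^ n)) N"
          by (simp only: coeff_smult distrib_left mult.assoc)
        also have "smult (of_nat (Suc n)) ([:0, 1:] * pderiv \<phi> * \<phi> ^ n)
            = [:0, 1:] * pderiv (\<phi> ^ Suc n)"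
          by (simp only: pderiv_power_Suc mult_smult_left mult_smult_right mult_ac)
        also have "coeff \<dots> N = of_nat N * ?c"
          by (rule coeff_X_mult_pderiv)
        \<comment> \<open>Since n = s + N, (n + 1) s + N = n (s + 1).\<close>
        also have "of_nat (Suc n) * of_nat s * ?c + of_nat N * ?c = of_nat n * (of_nat (Suc s) * ?c)"
          by (simp add: Nle[symmetric] algebra_simps)
        finally have "of_nat n * (of_nat (Suc n) * (T ^ Suc s) $ Suc n)
            = of_nat n * (of_nat (Suc s) * ?c)"
          by (simp only: mult_ac)
        then show ?thesis
          using False Suc by (simp add: N_def del: of_nat_Suc power_Suc)
      qed
    qed
  qed
qed

section \<open>Root decomposition and the generating function of 0-1-trees\<close>

text \<open>The condition \<open>t \<noteq> Leaf\<close> only matters for \<open>n = 0\<close>: it makes the constant term of \<open>T\<close> vanish.\<close>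

definition trees :: "nat \<Rightarrow> bool option tree set" where
  "trees n = {t. zero_one_tree t \<and> size t = n \<and> t \<noteq> Leaf}"

lemma trees_0 [simp]: "trees 0 = {}"
  by (auto simp: trees_def)

text \<open>The root is a single vertex, has only a right child, only a left child, or both and a
  label \<open>b\<close>. Members of \<open>trees i\<close> are nonempty, so the classes are
  disjoint.\<close>

lemma trees_Suc:
  "trees (Suc n) = (if n = 0 then {Node Leaf None Leaf} else {})
     \<union> Node Leaf None ` trees n \<union> (\<lambda>l. Node l None Leaf) ` trees n
     \<union> (\<lambda>(i, l, b, r). Node l (Some b) r) `
         (SIGMA i:{0..n}. trees i \<times> UNIV \<times> trees (n - i))"
    (is "_ = ?A \<union> ?B \<union> ?C \<union> ?D")
proof (intro equalityI subsetI)
  fix t assume t: "t \<in> trees (Suc n)"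
  then obtain l a r where [simp]: "t = Node l a r"
    by (cases t) (auto simp: trees_def)
  show "t \<in> ?A \<union> ?B \<union> ?C \<union> ?D"
  proof (cases "l = Leaf \<or> r = Leaf")
    case True
    then show ?thesis using t by (auto simp: trees_def)
  next
    case False
    with t obtain b where "a = Some b" by (auto simp: trees_def)
    then have S: "(size l, l, b, r) \<in> (SIGMA i:{0..n}. trees i \<times> UNIV \<times> trees (n - i))"
      using t False by (auto simp: trees_def)
    have "t \<in> ?D"
      by (rule image_eqI[OF _ S]) (simp add: \<open>a = Some b\<close>)
    then show ?thesis ..
  qed
qed (auto simp: trees_def split: if_splits)

lemma finite_trees: "finite (trees n)"
proof (induction n rule: less_induct)
  case (less n)
  show ?case
  proof (cases n)
    case (Suc m)
    then have "finite (trees i)" if "i \<le> m" for i using less that by simp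
    then show ?thesis unfolding Suc trees_Suc by (auto intro!: finite_imageI finite_SigmaI)
  qed simp
qed

text \<open>Power series in \<open>x\<close> whose coefficients are polynomials in \<open>y\<close>.\<close>

definition tree_gf :: "int poly fps" where
  "tree_gf = Abs_fps (\<lambda>n. \<Sum>t\<in>trees n. monom 1 (right_edges t))"

text \<open>The outer variable is \<open>u\<close>, the inner one is \<open>y\<close>.\<close>

definition tree_poly :: "int poly poly" where
  "tree_poly = [:1, 1 + monom 1 1, monom 2 1:]"

lemma tree_gf_nth: "tree_gf $ n = (\<Sum>t\<in>trees n. monom 1 (right_edges t))"
  by (simp add: tree_gf_def)

lemma coeff_tree_gf:
  assumes "n \<ge> 1"
  shows "coeff (tree_gf $ n) m = int (BoNa n (m + 1))"
proof -
  have "coeff (tree_gf $ n) m = int (card {t \<in> trees n. right_edges t = m})"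
    by (simp add: tree_gf_nth coeff_sum sum.If_cases finite_trees Int_def)
  also have "{t \<in> trees n. right_edges t = m}
      = {t. zero_one_tree t \<and> size t = n \<and> right_edges t + 1 = m + 1}"
    using assms by (auto simp: trees_def)
  finally show ?thesis by (simp add: BoNa_def)
qed

text \<open>An only right child costs a factor y, an only left child costs 1, and two children cost
  y times 2 for the choice of label.\<close>

lemma tree_gf_nth_Suc:
  "tree_gf $ Suc n = (if n = 0 then 1 else 0) + (1 + monom 1 1) * tree_gf $ n
     + monom 2 1 * (tree_gf ^ 2) $ n"
proof -
  let ?w = "\<lambda>t. monom (1 :: int) (right_edges t)"
  let ?A = "if n = 0 then {Node Leaf None Leaf} else {}"
  let ?B = "Node Leaf None ` trees n"
  let ?C = "(\<lambda>l. Node l None Leaf) ` trees n"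
  let ?S = "SIGMA i:{0..n}. trees i \<times> (UNIV :: bool set) \<times> trees (n - i)"
  let ?D = "(\<lambda>(i, l, b, r). Node l (Some b) r) ` ?S"
  have fin: "finite ?A" "finite ?B" "finite ?C" "finite ?D"
    by (auto intro!: finite_imageI finite_SigmaI simp: finite_trees)
  have "tree_gf $ Suc n = sum ?w ?A + sum ?w ?B + sum ?w ?C + sum ?w ?D"
    unfolding tree_gf_nth trees_Suc
    by (subst sum.union_disjoint, use fin in \<open>auto simp: trees_def split: if_splits\<close>)+
  also have "sum ?w ?A = (if n = 0 then 1 else 0)"
    by simp
  also have "sum ?w ?B = monom 1 1 * tree_gf $ n"
    by (subst sum.reindex)
      (auto simp: inj_on_def tree_gf_nth sum_distrib_left mult_monom trees_def intro!: sum.cong)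
  also have "sum ?w ?C = tree_gf $ n"
    by (subst sum.reindex) (auto simp: inj_on_def tree_gf_nth)
  \<comment> \<open>The reindexing is injective because \<open>i\<close> is the size of
    \<open>l\<close>; the right edge at the root supplies \<open>monom 1 1\<close>.\<close>
  also have "sum ?w ?D = (\<Sum>(i, l, b, r)\<in>?S. monom 1 1 * (?w l * ?w r))"
    by (subst sum.reindex)
      (auto simp: inj_on_def trees_def mult_monom add_ac intro!: sum.cong)
  also have "\<dots> = (\<Sum>i=0..n. \<Sum>l\<in>trees i. \<Sum>b\<in>(UNIV :: bool set). \<Sum>r\<in>trees (n - i).
      monom 1 1 * (?w l * ?w r))"
    by (simp only: sum.cartesian_product, subst sum.Sigma)
      (auto intro!: finite_cartesian_product simp: finite_trees)
  also have "\<dots> = monom 2 1 * (tree_gf ^ 2) $ n"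
  proof -
    have "monom 2 1 = 2 * (monom 1 1 :: int poly)"
      by (rule poly_eqI) (simp add: numeral_poly)
    then have "(\<Sum>l\<in>trees i. \<Sum>b\<in>(UNIV :: bool set). \<Sum>r\<in>trees (n - i).
        monom 1 1 * (?w l * ?w r)) = monom 2 1 * (tree_gf $ i * tree_gf $ (n - i))" for i
      unfolding tree_gf_nth sum_product by (simp add: sum_distrib_left mult.assoc)
    then show ?thesis
      by (simp only: power2_eq_square fps_mult_nth sum_distrib_left)
  qed
  finally show ?thesis by (simp add: algebra_simps)
qed

lemma tree_gf_eq:
  "tree_gf = fps_X * (\<Sum>i\<le>degree tree_poly. fps_const (coeff tree_poly i) * tree_gf ^ i)"
proof (rule fps_ext)
  fix n
  have "degree tree_poly = 2" by (simp add: tree_poly_def)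
  then show "tree_gf $ n = (fps_X * (\<Sum>i\<le>degree tree_poly. fps_const (coeff tree_poly i) * tree_gf ^ i)) $ n"
    by (cases n) (simp_all add: tree_gf_nth[of 0] tree_gf_nth_Suc tree_poly_def numeral_2_eq_2)
qed

section \<open>Coefficients of powers of \<open>tree_poly\<close>\<close>

lemma coeff_one_plus_linear_power:
  "coeff ([:1, b:] ^ n :: 'a::comm_ring_1 poly) i = of_nat (n choose i) * b ^ i"
proof (cases "i \<le> n")
  case False
  have "degree ([:1, b:] ^ n) \<le> n"
    using degree_power_le[of "[:1, b:]" n] by (cases "b = 0") auto
  with False show ?thesis by (simp add: coeff_eq_0 binomial_eq_0)
qed (simp add: coeff_linear_poly_power)

text \<open>Pulling out u^k leaves the coefficient of u^(n-1-k) in (1 + 2u)^k (1 + u)^(n-k), a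
  convolution of two binomial expansions.\<close>

lemma coeff_split_power:
  assumes "k \<le> n" "n \<ge> 1"
  shows "coeff ([:0, 1, 2:] ^ k * [:1, 1:] ^ (n - k) :: 'a::comm_ring_1 poly) (n - 1)
      = (\<Sum>j\<le>k. 2 ^ j * of_nat (k choose j) * of_nat ((n - k) choose (j + 1)))"
proof -
  let ?f = "\<lambda>j. 2 ^ j * of_nat (k choose j) * of_nat ((n - k) choose (j + 1)) :: 'a"
  have "([:0, 1, 2:] :: 'a poly) = monom 1 1 * [:1, 2:]"
    by (simp add: monom_Suc)
  then have eq: "([:0, 1, 2:] ^ k * [:1, 1:] ^ (n - k) :: 'a poly)
      = monom 1 k * ([:1, 2:] ^ k * [:1, 1:] ^ (n - k))"
    by (simp only: power_mult_distrib monom_power mult_1 power_one mult.assoc)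
  show ?thesis
  proof (cases "k = n")
    case True
    with assms show ?thesis unfolding eq by (simp add: coeff_monom_mult)
  next
    case False
    with assms have k: "k < n" by simp
    define N where "N = n - 1 - k"
    have "coeff ([:0, 1, 2:] ^ k * [:1, 1:] ^ (n - k) :: 'a poly) (n - 1)
        = coeff ([:1, 2:] ^ k * [:1, 1:] ^ (n - k) :: 'a poly) N"
      using k by (simp add: eq coeff_monom_mult N_def)
    also have "\<dots> = (\<Sum>j\<le>N. ?f j)"
      unfolding coeff_mult
    proof (intro sum.cong refl)
      fix j assume "j \<in> {..N}"
      \<comment> \<open>The complement of N - j in n - k is j + 1, as N = n - 1 - k.\<close>
      then have "(n - k) choose (N - j) = (n - k) choose (j + 1)"
        using k by (subst binomial_symmetric) (auto simp: N_def)
      then show "coeff ([:1, 2:] ^ k :: 'a poly) j * coeff ([:1, 1:] ^ (n - k)) (N - j) = ?f j"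
        by (simp add: coeff_one_plus_linear_power mult_ac)
    qed
    also have "\<dots> = (\<Sum>j\<le>k. ?f j)"
    proof (rule sum.mono_neutral_cong)
      show "?f j = 0" if "j \<in> {..k} - {..N}" for j
        using that k by (auto simp: N_def binomial_eq_0)
      show "?f j = 0" if "j \<in> {..N} - {..k}" for j
        using that by (auto simp: binomial_eq_0)
    qed simp_all
    finally show ?thesis .
  qed
qed

lemma coeff_tree_poly_power:
  assumes "m < n"
  shows "coeff (coeff (tree_poly ^ n) (n - 1)) m = int (n choose m) *
    (\<Sum>j\<le>m. 2 ^ j * int (m choose j) * int ((n - m) choose (j + 1)))"
proof -
  define S where "S k = (\<Sum>j\<le>k. 2 ^ j * int (k choose j) * int ((n - k) choose (j + 1)))" for k
  \<comment> \<open>Only the first summand carries y, so the k-th binomial term is homogeneous of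
    degree k in y and just k = m survives.\<close>
  have eq: "tree_poly = smult (monom 1 1) [:0, 1, 2:] + [:1, 1:]"
    by (simp add: tree_poly_def monom_Suc monom_0 numeral_poly add.commute)
  have "tree_poly ^ n = (\<Sum>k\<le>n. of_nat (n choose k) *
      smult (monom 1 k) ([:0, 1, 2:] ^ k * [:1, 1:] ^ (n - k)))"
    by (simp only: eq binomial_ring smult_power monom_power power_one mult_1
        mult_smult_left mult_smult_right mult.assoc)
  also have "coeff \<dots> (n - 1) = (\<Sum>k\<le>n. of_nat (n choose k) * (monom 1 k * of_int (S k)))"
    unfolding coeff_sum
  proof (intro sum.cong refl)
    fix k assume "k \<in> {..n}"
    then have "coeff ([:0, 1, 2:] ^ k * [:1, 1:] ^ (n - k) :: int poly poly) (n - 1) = of_int (S k)"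
      using assms by (subst coeff_split_power) (auto simp: S_def)
    then show "coeff (of_nat (n choose k) *
          smult (monom 1 k) ([:0, 1, 2:] ^ k * [:1, 1:] ^ (n - k))) (n - 1)
        = of_nat (n choose k) * (monom 1 k * of_int (S k) :: int poly)"
      by (simp add: of_nat_poly)
  qed
  finally show ?thesis
    using assms
    by (simp add: coeff_sum of_nat_poly of_int_poly S_def if_distrib cong: if_cong)
qed

theorem theorem3p2:
  fixes n k :: nat
  assumes "n \<ge> 1" and "k \<ge> 1" and "real k \<le> (real n + 1) / 2"
  shows "real (BoNa n k) =
    1 / real n * real (n choose (k - 1)) *
      (\<Sum>j = 0..k - 1. 2 ^ j * real ((k - 1) choose j) * real ((n - k + 1) choose (j + 1)))"
proof -
  define m where "m = k - 1"
  \<comment> \<open>The bound on \<open>k\<close> together with n \<ge> 1 gives k \<le> n, so the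
    truncated subtractions are exact.\<close>
  have m: "k = m + 1" "m < n" "n - k + 1 = n - m"
    using assms by (auto simp: m_def)
  have "of_nat n * tree_gf $ n = coeff (tree_poly ^ n) (n - 1)"
    using lagrange_inversion[OF tree_gf_eq, of 1 n] assms(1) by simp
  then have "coeff (of_nat n * tree_gf $ n) m = coeff (coeff (tree_poly ^ n) (n - 1)) m"
    by (rule arg_cong)
  then have "coeff (of_nat n * tree_gf $ n) m = int (n choose m) *
      (\<Sum>j\<le>m. 2 ^ j * int (m choose j) * int ((n - m) choose (j + 1)))"
    by (simp only: coeff_tree_poly_power[OF m(2)])
  then have "int n * int (BoNa n k) = int (n choose m) *
      (\<Sum>j\<le>m. 2 ^ j * int (m choose j) * int ((n - m) choose (j + 1)))"
    using assms(1) by (simp add: m coeff_tree_gf of_nat_poly)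
  then have "real_of_int (int n * int (BoNa n k)) = real_of_int (int (n choose m) *
      (\<Sum>j\<le>m. 2 ^ j * int (m choose j) * int ((n - m) choose (j + 1))))"
    by (rule arg_cong)
  then have "real n * real (BoNa n k) = real (n choose m) *
      (\<Sum>j=0..m. 2 ^ j * real (m choose j) * real ((n - m) choose (j + 1)))"
    by (simp add: atMost_atLeast0)
  then show ?thesis
    unfolding m(3) m_def[symmetric] using assms(1) by (simp add: eq_divide_eq mult.commute)
qed

end
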